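(* Let $\mathbb{F}$ be a field of characteristic zero with multiplicative identity $1_{\mathbb{F}}$. Let $\psi$ be the $\mathbb{F}$-linear functional on $\mathbb{F}[\alpha_1,\alpha_2]$ defined on monomials, for all $k,l\in\mathbb{N}$, by \[ \psi(\alpha_1^k\alpha_2^l)=\begin{cases}\Omega(m,n)\,1_{\mathbb{F}} & \text{if } k=2m \text{ and } l=2n,\\ 0 & \text{otherwise.}\end{cases} \] Then $\psi$ is a circular integral functional on $\mathbb{F}[\alpha_1,\alpha_2]$ with respect to $S^1$, and it is the only one.
   Context: $\mathbb{N}$ includes $0$. For $m,n\in\mathbb{N}$, $\Omega(m,n)=\dfrac{(2m)!(2n)!}{4^{m+n}\,m!\,n!\,(m+n)!}\in\mathbb{Q}$, and $a1_{\mathbb{F}}$ denotes the image of $a\in\mathbb{Q}$ in $\mathbb{F}$. Let $\mathbb{A}=\mathbb{F}^2$ (points $[x,y]$), $S^1=\{[x,y]\in\mathbb{A}: x^2+y^2=1_{\mathbb{F}}\}$, and let $\varepsilon$ be the evaluation map sending a polynomial to the function $\mathbb{A}\to\mathbb{F}$ it defines. $SO(2,\mathbb{F})$ is the group of $2\times 2$ matrices $h$ over $\mathbb{F}$ with $h^{-1}=h^T$ and $\det h=1_{\mathbb{F}}$; it acts on $\mathbb{F}[\alpha_1,\alpha_2]$ by $h\cdot\pi(\alpha_1,\alpha_2)=\pi(h_{11}\alpha_1+h_{21}\alpha_2,\,h_{12}\alpha_1+h_{22}\alpha_2)$. A circular integral functional with respect to $S^1$ is an $\mathbb{F}$-linear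 map $\phi:\mathbb{F}[\alpha_1,\alpha_2]\to\mathbb{F}$ such that (Normalization) $\phi(\mathbf{1})=1_{\mathbb{F}}$ where $\mathbf{1}$ is the constant polynomial $1$; (Locality) $\phi(\pi)=0$ whenever $\varepsilon(\pi)$ vanishes at every point of $S^1$; (Invariance) $\phi(h\cdot\pi)=\phi(\pi)$ for all $\pi$ and all $h\in SO(2,\mathbb{F})$. *)

theory Defs
  imports "HOL-Analysis.Analysis" "HOL-Computational_Algebra.Polynomial"
begin

(* F[alpha1, alpha2] is represented as (F[alpha1])[alpha2], i.e. by the type 'a poly poly:
   the coefficient of alpha1^k alpha2^l in p is coeff (coeff p l) k. *)

definition \<alpha>1 :: "'a::comm_ring_1 poly poly" where
  "\<alpha>1 = [:[:0, 1:]:]"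

definition \<alpha>2 :: "'a::comm_ring_1 poly poly" where
  "\<alpha>2 = [:0, 1:]"

abbreviation scale2 :: "'a::comm_ring_1 \<Rightarrow> 'a poly poly \<Rightarrow> 'a poly poly" where
  "scale2 c p \<equiv> smult [:c:] p"

(* poly p [:y:] substitutes y for alpha2; the outer poly substitutes x for alpha1. *)
definition eval2 :: "'a::comm_ring_1 poly poly \<Rightarrow> 'a ^ 2 \<Rightarrow> 'a" where
  "eval2 p v = poly (poly p [:v $ 2:]) (v $ 1)"

definition subst2 :: "'a::comm_ring_1 poly poly \<Rightarrow> 'a poly poly \<Rightarrow> 'a poly poly \<Rightarrow> 'a poly poly" where
  "subst2 p a b =
    (\<Sum>l\<le>degree p. \<Sum>k\<le>degree (coeff p l). scale2 (coeff (coeff p l) k) (a ^ k * b ^ l))"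

definition S1 :: "('a::field ^ 2) set" where
  "S1 = {v. (v $ 1)\<^sup>2 + (v $ 2)\<^sup>2 = 1}"

definition SO2 :: "('a::field ^ 2 ^ 2) set" where
  "SO2 = {h. invertible h \<and> matrix_inv h = transpose h \<and> det h = 1}"

definition act :: "'a::field ^ 2 ^ 2 \<Rightarrow> 'a poly poly \<Rightarrow> 'a poly poly" where
  "act h p = subst2 p
    (scale2 (h $ 1 $ 1) \<alpha>1 + scale2 (h $ 2 $ 1) \<alpha>2)
    (scale2 (h $ 1 $ 2) \<alpha>1 + scale2 (h $ 2 $ 2) \<alpha>2)"

definition circular_integral_functional :: "('a::field poly poly \<Rightarrow> 'a) \<Rightarrow> bool" where
  "circular_integral_functional \<phi> \<longleftrightarrow>
    Vector_Spaces.linear scale2 (*) \<phi> \<and>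
    \<phi> 1 = 1 \<and>
    (\<forall>p. (\<forall>v\<in>S1. eval2 p v = 0) \<longrightarrow> \<phi> p = 0) \<and>
    (\<forall>p. \<forall>h\<in>SO2. \<phi> (act h p) = \<phi> p)"

definition Omega :: "nat \<Rightarrow> nat \<Rightarrow> rat" where
  "Omega m n = (fact (2 * m) * fact (2 * n)) / (4 ^ (m + n) * fact m * fact n * fact (m + n))"

definition psi_monom :: "nat \<Rightarrow> nat \<Rightarrow> 'a::field_char_0" where
  "psi_monom k l =
    (if even k \<and> even l then of_rat (Omega (k div 2) (l div 2)) else 0)"

(* The linear extension of psi_monom; characterised by psi_linear and psi_monomial below. *)
definition psi :: "'a::field_char_0 poly poly \<Rightarrow> 'a" where
  "psi p = (\<Sum>l\<le>degree p. \<Sum>k\<le>degree (coeff p l). coeff (coeff p l) k * psi_monom k l)"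

lemma psi_bound:
  assumes "degree p \<le> N" and "\<And>l. degree (coeff p l) \<le> M"
  shows "psi p = (\<Sum>l\<le>N. \<Sum>k\<le>M. coeff (coeff p l) k * psi_monom k l)"
proof -
  have inner: "(\<Sum>k\<le>degree (coeff p l). coeff (coeff p l) k * psi_monom k l)
      = (\<Sum>k\<le>M. coeff (coeff p l) k * psi_monom k l)" for l
    using assms(2) by (intro sum.mono_neutral_left) (auto simp: coeff_eq_0)
  have "psi p = (\<Sum>l\<le>degree p. \<Sum>k\<le>M. coeff (coeff p l) k * psi_monom k l)"
    by (simp add: psi_def inner)
  also have "\<dots> = (\<Sum>l\<le>N. \<Sum>k\<le>M. coeff (coeff p l) k * psi_monom k l)"
    using assms(1) by (intro sum.mono_neutral_left) (auto simp: coeff_eq_0)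
  finally show ?thesis .
qed

lemma degree_coeff_bound: "\<exists>M. \<forall>l. degree (coeff p l) \<le> (M::nat)"
proof -
  have "degree (coeff p l) \<le> (\<Sum>i\<le>degree p. degree (coeff p i))" for l
    by (cases "l \<le> degree p") (auto simp: coeff_eq_0 intro: member_le_sum)
  then show ?thesis by blast
qed

lemma psi_linear: "Vector_Spaces.linear scale2 (*) psi"
proof -
  have add: "psi (p + q) = psi p + psi q" for p q :: "'a poly poly"
  proof -
    obtain A B where A: "\<And>l. degree (coeff p l) \<le> A" and B: "\<And>l. degree (coeff q l) \<le> B"
      using degree_coeff_bound by metis
    let ?N = "max (degree p) (degree q)" and ?M = "max A B"
    have M: "degree (coeff p l) \<le> ?M" "degree (coeff q l) \<le> ?M" for l
      using A[of l] B[of l] by auto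
    have "psi (p + q) = (\<Sum>l\<le>?N. \<Sum>k\<le>?M. coeff (coeff (p + q) l) k * psi_monom k l)"
      using M by (intro psi_bound) (auto intro: degree_add_le simp del: max.bounded_iff)
    moreover have "psi p = (\<Sum>l\<le>?N. \<Sum>k\<le>?M. coeff (coeff p l) k * psi_monom k l)"
      using M by (intro psi_bound) auto
    moreover have "psi q = (\<Sum>l\<le>?N. \<Sum>k\<le>?M. coeff (coeff q l) k * psi_monom k l)"
      using M by (intro psi_bound) auto
    ultimately show ?thesis
      by (simp add: sum.distrib distrib_right)
  qed
  have scale: "psi (scale2 c p) = c * psi p" for c and p :: "'a poly poly"
  proof -
    obtain A where A: "\<And>l. degree (coeff p l) \<le> A"
      using degree_coeff_bound by metis
    have "psi (scale2 c p) = (\<Sum>l\<le>degree p. \<Sum>k\<le>A. coeff (coeff (scale2 c p) l) k * psi_monom k l)"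
      using A by (intro psi_bound) (auto intro: order_trans[OF degree_smult_le])
    moreover have "psi p = (\<Sum>l\<le>degree p. \<Sum>k\<le>A. coeff (coeff p l) k * psi_monom k l)"
      using A by (intro psi_bound) auto
    ultimately show ?thesis
      by (simp add: sum_distrib_left mult.assoc)
  qed
  have one: "scale2 1 p = p" for p :: "'a poly poly"
    by (simp flip: one_pCons)
  have left: "scale2 (a + b) p = scale2 a p + scale2 b p" for a b and p :: "'a poly poly"
    by (simp flip: smult_add_left)
  show ?thesis
    by unfold_locales (auto simp: add scale one left smult_add_right algebra_simps)
qed

lemma alpha_monom: "\<alpha>1 ^ k * \<alpha>2 ^ l = (monom (monom 1 k) l :: 'a::comm_ring_1 poly poly)"
proof -
  have "\<alpha>1 ^ k = ([:monom 1 k:] :: 'a poly poly)"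
    by (induction k) (auto simp: \<alpha>1_def monom_Suc one_pCons monom_0)
  moreover have "\<alpha>2 ^ l = (monom 1 l :: 'a poly poly)"
    by (induction l) (auto simp: \<alpha>2_def monom_Suc monom_0)
  ultimately show ?thesis by (simp add: smult_monom)
qed

lemma psi_monomial_aux: "psi (\<alpha>1 ^ k * \<alpha>2 ^ l) = (psi_monom k l :: 'a::field_char_0)"
proof -
  have *: "coeff (coeff (monom (monom 1 k) l) i) j * psi_monom j i
      = (if i = l then if j = k then psi_monom k l else 0 else (0::'a))" for i j
    by (auto simp: coeff_monom)
  have "psi (monom (monom 1 k) l)
      = (\<Sum>i\<le>l. \<Sum>j\<le>k. coeff (coeff (monom (monom 1 k) l) i) j * psi_monom j i :: 'a)"
    by (intro psi_bound) (auto simp: degree_monom_le coeff_monom)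
  also have "\<dots> = (\<Sum>i\<le>l. if i = l then \<Sum>j\<le>k. if j = k then psi_monom k l else 0 else 0)"
    unfolding * by (intro sum.cong) auto
  also have "\<dots> = psi_monom k l"
    by simp
  finally show ?thesis
    by (simp add: alpha_monom)
qed

lemma psi_monomial:
  shows "psi (\<alpha>1 ^ (2 * m) * \<alpha>2 ^ (2 * n)) = of_rat (Omega m n)"
    and "\<nexists>m n. k = 2 * m \<and> l = 2 * n \<Longrightarrow> psi (\<alpha>1 ^ k * \<alpha>2 ^ l) = 0"
  by (auto simp: psi_monomial_aux psi_monom_def elim!: evenE)

end

theory Submission imports Defs begin

text \<open>
  Let \<open>D = \<alpha>1 \<partial>/\<partial>\<alpha>2 - \<alpha>2 \<partial>/\<partial>\<alpha>1\<close> be the infinitesimal rotation. A linear functional that kills the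
  image of \<open>D\<close>, is unchanged under multiplication by \<open>\<alpha>1\<^sup>2 + \<alpha>2\<^sup>2\<close> and sends 1 to 1 is determined by
  recursion on its moments, and \<open>psi\<close> is this functional.

  Invariance: a rotation \<open>h\<close> commutes with \<open>D\<close> and fixes \<open>\<alpha>1\<^sup>2 + \<alpha>2\<^sup>2\<close>, so \<open>psi \<circ> h\<close> has the
  same three properties and equals \<open>psi\<close>. Locality: the circle has infinitely many points, so a
  polynomial vanishing on it is a multiple of \<open>\<alpha>1\<^sup>2 + \<alpha>2\<^sup>2 - 1\<close>. Uniqueness: for a circular
  integral functional, invariance under the rationally parametrised rotations is a polynomial
  identity in the parameter \<open>t\<close> once denominators are cleared, and its coefficient of \<open>t\<close>
  says that the image of \<open>D\<close> is killed.
\<close>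

section \<open>Linear functionals, substitution and monomials\<close>

lemma scale2_1: "scale2 1 p = p"
  by (simp flip: one_pCons)

lemma scale2_add_left: "scale2 (c + d) p = scale2 c p + scale2 d p"
  by (simp flip: smult_add_left)

lemma scale2_sum: "scale2 c (sum f A) = (\<Sum>i\<in>A. scale2 c (f i))"
  by (induction A rule: infinite_finite_induct) (simp_all add: smult_add_right)

lemma scale2_minus_left: "scale2 (- c) p = - scale2 c p"
  by (metis minus_pCons minus_zero smult_minus_left)

lemma linear_scale2_iff:
  "Vector_Spaces.linear scale2 (*) (\<phi> :: 'a::field poly poly \<Rightarrow> 'a) \<longleftrightarrow>
    (\<forall>p q. \<phi> (p + q) = \<phi> p + \<phi> q) \<and> (\<forall>c p. \<phi> (scale2 c p) = c * \<phi> p)"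
proof
  assume "Vector_Spaces.linear scale2 (*) \<phi>"
  then interpret Vector_Spaces.linear scale2 "(*)" \<phi> .
  show "(\<forall>p q. \<phi> (p + q) = \<phi> p + \<phi> q) \<and> (\<forall>c p. \<phi> (scale2 c p) = c * \<phi> p)"
    by (simp add: add scale)
next
  assume *: "(\<forall>p q. \<phi> (p + q) = \<phi> p + \<phi> q) \<and> (\<forall>c p. \<phi> (scale2 c p) = c * \<phi> p)"
  show "Vector_Spaces.linear scale2 (*) \<phi>"
    by unfold_locales (use * in \<open>auto simp: scale2_1 scale2_add_left smult_add_right algebra_simps\<close>)
qed

text \<open>The inner degree in \<open>subst2\<close> varies with \<open>l\<close>. Uniform bounds,
  padded with zero coefficients, let the sums for two polynomials be compared termwise.\<close>

lemma subst2_bound: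
  assumes "degree p \<le> N" and "\<And>l. degree (coeff p l) \<le> M"
  shows "subst2 p a b = (\<Sum>l\<le>N. \<Sum>k\<le>M. scale2 (coeff (coeff p l) k) (a ^ k * b ^ l))"
proof -
  have inner: "(\<Sum>k\<le>degree (coeff p l). scale2 (coeff (coeff p l) k) (a ^ k * b ^ l))
      = (\<Sum>k\<le>M. scale2 (coeff (coeff p l) k) (a ^ k * b ^ l))" for l
    using assms(2) by (intro sum.mono_neutral_left) (auto simp: coeff_eq_0)
  show ?thesis
    unfolding subst2_def inner
    using assms(1) by (intro sum.mono_neutral_left) (auto simp: coeff_eq_0)
qed

lemma subst2_add: "subst2 (p + q) a b = subst2 p a b + subst2 q a b"
proof -
  obtain A B where A: "\<And>l. degree (coeff p l) \<le> A" and B: "\<And>l. degree (coeff q l) \<le> B"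
    using degree_coeff_bound by metis
  let ?N = "max (degree p) (degree q)" and ?M = "max A B"
  have M: "degree (coeff p l) \<le> ?M" "degree (coeff q l) \<le> ?M" for l
    using A[of l] B[of l] by auto
  have "subst2 (p + q) a b
      = (\<Sum>l\<le>?N. \<Sum>k\<le>?M. scale2 (coeff (coeff (p + q) l) k) (a ^ k * b ^ l))"
    using M by (intro subst2_bound) (auto intro: degree_add_le simp del: max.bounded_iff)
  moreover have "subst2 p a b = (\<Sum>l\<le>?N. \<Sum>k\<le>?M. scale2 (coeff (coeff p l) k) (a ^ k * b ^ l))"
    using M by (intro subst2_bound) auto
  moreover have "subst2 q a b = (\<Sum>l\<le>?N. \<Sum>k\<le>?M. scale2 (coeff (coeff q l) k) (a ^ k * b ^ l))"
    using M by (intro subst2_bound) auto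
  ultimately show ?thesis
    by (simp add: sum.distrib scale2_add_left)
qed

lemma subst2_scale2:
  fixes p :: "'a::idom poly poly"
  shows "subst2 (scale2 c p) a b = scale2 c (subst2 p a b)"
proof -
  obtain A where A: "\<And>l. degree (coeff p l) \<le> A"
    using degree_coeff_bound by metis
  have "subst2 (scale2 c p) a b
      = (\<Sum>l\<le>degree p. \<Sum>k\<le>A. scale2 (coeff (coeff (scale2 c p) l) k) (a ^ k * b ^ l))"
    using A by (intro subst2_bound) (auto intro: order_trans[OF degree_smult_le])
  moreover have "subst2 p a b
      = (\<Sum>l\<le>degree p. \<Sum>k\<le>A. scale2 (coeff (coeff p l) k) (a ^ k * b ^ l))"
    using A by (intro subst2_bound) auto
  ultimately show ?thesis
    by (simp add: scale2_sum mult.commute[of c])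
qed

lemma scale2_monom: "scale2 c (\<alpha>1 ^ k * \<alpha>2 ^ l) = monom (monom c k) l"
  by (simp add: alpha_monom smult_monom)

lemma subst2_monomial:
  fixes a b :: "'a::comm_ring_1 poly poly"
  shows "subst2 (\<alpha>1 ^ k * \<alpha>2 ^ l) a b = a ^ k * b ^ l"
proof -
  have "subst2 (\<alpha>1 ^ k * \<alpha>2 ^ l) a b
      = (\<Sum>j\<le>l. \<Sum>i\<le>k. scale2 (coeff (coeff (monom (monom 1 k) l) j) i) (a ^ i * b ^ j))"
    unfolding alpha_monom
    by (intro subst2_bound) (auto simp: degree_monom_le coeff_monom)
  also have "\<dots> = (\<Sum>j\<le>l. if j = l then \<Sum>i\<le>k. if i = k then a ^ k * b ^ l else 0 else 0)"
    by (intro sum.cong refl) (auto simp: coeff_monom scale2_1 if_distrib[of "\<lambda>x. scale2 x _"] cong: if_cong)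
  also have "\<dots> = a ^ k * b ^ l"
    by simp
  finally show ?thesis .
qed

text \<open>A polynomial is the finite double sum of its terms; the scalar \<open>0\<close> in
  \<open>mono\<close> supplies the empty sum.\<close>

lemma monomial_induct:
  fixes p :: "'a::comm_ring_1 poly poly"
  assumes add: "\<And>p q. P p \<Longrightarrow> P q \<Longrightarrow> P (p + q)"
    and mono: "\<And>c k l. P (scale2 c (\<alpha>1 ^ k * \<alpha>2 ^ l))"
  shows "P p"
proof -
  have zero: "P 0"
    using mono[of 0 0 0] by simp
  have sum: "finite A \<Longrightarrow> (\<And>i. i \<in> A \<Longrightarrow> P (f i)) \<Longrightarrow> P (sum f A)"
    for f and A :: "nat set"
    by (induction A rule: finite_induct) (auto simp: zero add)
  have "p = (\<Sum>l\<le>degree p. monom (coeff p l) l)"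
    by (simp add: poly_as_sum_of_monoms)
  also have "\<dots> = (\<Sum>l\<le>degree p. monom (\<Sum>k\<le>degree (coeff p l). monom (coeff (coeff p l) k) k) l)"
    by (simp add: poly_as_sum_of_monoms)
  also have "\<dots> = (\<Sum>l\<le>degree p. \<Sum>k\<le>degree (coeff p l).
      scale2 (coeff (coeff p l) k) (\<alpha>1 ^ k * \<alpha>2 ^ l))"
    by (simp add: scale2_monom monom_sum)
  finally have eq: "p = (\<Sum>l\<le>degree p. \<Sum>k\<le>degree (coeff p l).
      scale2 (coeff (coeff p l) k) (\<alpha>1 ^ k * \<alpha>2 ^ l))" .
  show ?thesis
    by (subst eq) (intro sum finite_atMost mono)
qed

lemma linear_eqI:
  fixes \<phi> \<rho> :: "'a::field poly poly \<Rightarrow> 'a"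
  assumes "Vector_Spaces.linear scale2 (*) \<phi>" "Vector_Spaces.linear scale2 (*) \<rho>"
    and "\<And>k l. \<phi> (\<alpha>1 ^ k * \<alpha>2 ^ l) = \<rho> (\<alpha>1 ^ k * \<alpha>2 ^ l)"
  shows "\<phi> = \<rho>"
proof
  fix p
  show "\<phi> p = \<rho> p"
    using assms by (induction p rule: monomial_induct) (auto simp: linear_scale2_iff)
qed

section \<open>Moments of the circle\<close>

text \<open>The factorials contribute the quotient (2m+2)(2m+1) / (4(m+1)(m+n+1)), in which 2(m+1)
  cancels.\<close>

lemma Omega_Suc: "2 * of_nat (m + n + 1) * Omega (Suc m) n = of_nat (2 * m + 1) * Omega m n"
proof -
  have f: "fact (2 * Suc m) = (of_nat (2 * m + 2) * of_nat (2 * m + 1) * fact (2 * m) :: rat)"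
    by (simp add: algebra_simps)
  have g: "fact (Suc m) = (of_nat (m + 1) * fact m :: rat)"
    "fact (Suc m + n) = (of_nat (m + n + 1) * fact (m + n) :: rat)"
    by (simp_all add: algebra_simps)
  have pos: "of_nat (m + 1) \<noteq> (0 :: rat)" "of_nat (m + n + 1) \<noteq> (0 :: rat)"
    by (simp_all only: of_nat_eq_0_iff)
  have "of_nat (2 * m + 2) = (2 * of_nat (m + 1) :: rat)"
    by simp
  then show ?thesis
    unfolding Omega_def f g using pos
    by (simp add: divide_simps del: of_nat_add of_nat_mult of_nat_Suc fact_Suc)
qed

lemma psi_monom_commute: "psi_monom k l = psi_monom l k"
  by (simp add: psi_monom_def Omega_def add.commute mult.commute mult.left_commute)

lemma psi_monom_rec:
  "of_nat (k + l + 2) * psi_monom (k + 2) l = (of_nat (k + 1) * psi_monom k l :: 'a::field_char_0)"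
proof (cases "even k \<and> even l")
  case True
  then obtain m n where [simp]: "k = 2 * m" "l = 2 * n"
    by (auto elim!: evenE)
  have "(of_rat (2 * of_nat (m + n + 1) * Omega (Suc m) n) :: 'a)
      = of_rat (of_nat (2 * m + 1) * Omega m n)"
    by (simp only: Omega_Suc)
  then show ?thesis
    by (simp add: psi_monom_def of_rat_mult of_rat_add algebra_simps)
qed (auto simp: psi_monom_def)

lemma psi_monom_rec':
  "of_nat (k + l + 2) * psi_monom k (l + 2) = (of_nat (l + 1) * psi_monom k l :: 'a::field_char_0)"
  using psi_monom_rec[of l k, where 'a='a] by (simp add: psi_monom_commute add.commute)

text \<open>Adding the two recurrences gives the factor (k+1) + (l+1) = k+l+2, which is nonzero in
  characteristic zero.\<close>

lemma psi_monom_radial: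
  "psi_monom (k + 2) l + psi_monom k (l + 2) = (psi_monom k l :: 'a::field_char_0)"
proof -
  have "of_nat (k + l + 2) * (psi_monom (k + 2) l + psi_monom k (l + 2))
      = of_nat (k + l + 2) * (psi_monom k l :: 'a)"
    unfolding distrib_left psi_monom_rec psi_monom_rec' by (simp add: algebra_simps)
  moreover have "of_nat (k + l + 2) \<noteq> (0 :: 'a)"
    by (simp only: of_nat_eq_0_iff)
  ultimately show ?thesis
    by simp
qed

text \<open>Off the axes both sides, multiplied by k+l, reduce to the same multiple of
  \<open>psi_monom (k - 1) (l - 1)\<close>. On the axes a truncated subtraction comes with the
  factor 0, and the opposite side has an exponent 1.\<close>

lemma psi_monom_tangential:
  "of_nat l * psi_monom (k + 1) (l - 1) = (of_nat k * psi_monom (k - 1) (l + 1) :: 'a::field_char_0)"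
proof (cases "k = 0 \<or> l = 0")
  case True
  then show ?thesis
    by (cases k; cases l) (auto simp: psi_monom_def)
next
  case False
  then obtain i j where ij: "k = Suc i" "l = Suc j"
    by (metis not0_implies_Suc)
  have "of_nat (i + j + 2) * (of_nat (j + 1) * psi_monom (i + 2) j)
      = of_nat (i + j + 2) * (of_nat (i + 1) * psi_monom i (j + 2) :: 'a)"
    unfolding mult.left_commute[of "of_nat (i + j + 2)"] psi_monom_rec psi_monom_rec' by simp
  moreover have "of_nat (i + j + 2) \<noteq> (0 :: 'a)"
    by (simp only: of_nat_eq_0_iff)
  ultimately show ?thesis
    by (simp add: ij)
qed

text \<open>Solving the two relations together expresses \<open>c (k + 2) l\<close> and
  \<open>c k (l + 2)\<close> through \<open>c k l\<close>, so induction on the total degree leaves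
  only exponents at most 1.\<close>

lemma circle_moments_unique:
  fixes c :: "nat \<Rightarrow> nat \<Rightarrow> 'a::field_char_0"
  assumes one: "c 0 0 = 1"
    and radial: "\<And>k l. c (k + 2) l + c k (l + 2) = c k l"
    and tangential: "\<And>k l. of_nat l * c (k + 1) (l - 1) = of_nat k * c (k - 1) (l + 1)"
  shows "c k l = psi_monom k l"
proof (induction "k + l" arbitrary: k l rule: less_induct)
  case less
  have pos: "of_nat (k + l + 2) \<noteq> (0 :: 'a)" for k l
    by (simp only: of_nat_eq_0_iff)
  have t: "of_nat (l + 1) * c (k + 2) l = of_nat (k + 1) * c k (l + 2)" for k l
    using tangential[of "l + 1" "k + 1"] by simp
  have rec: "of_nat (k + l + 2) * c (k + 2) l = of_nat (k + 1) * c k l" for k l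
    using t[of l k] by (simp flip: radial[of k l] add: algebra_simps)
  have rec': "of_nat (k + l + 2) * c k (l + 2) = of_nat (l + 1) * c k l" for k l
    using t[of l k] by (simp flip: radial[of k l] add: algebra_simps)
  consider i where "k = i + 2" | j where "l = j + 2" | "k \<le> 1" "l \<le> 1"
    by (metis Suc_1 add.commute le_Suc_ex not_less_eq_eq)
  then show ?case
  proof cases
    case 1
    then have "of_nat (i + l + 2) * c k l = of_nat (i + l + 2) * psi_monom k l"
      using less[of i l] by (simp only: rec psi_monom_rec)
    then show ?thesis
      using pos by simp
  next
    case 2
    then have "of_nat (k + j + 2) * c k l = of_nat (k + j + 2) * psi_monom k l"
      using less[of k j] by (simp only: rec' psi_monom_rec')
    then show ?thesis
      using pos by simp
  next
    case 3
    \<comment> \<open>In these instances one of the two factors \<open>of_nat l\<close>,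
      \<open>of_nat k\<close> is zero and the other is 1 or 2.\<close>
    have "c (Suc 0) 0 = 0" "c 0 (Suc 0) = 0" "c (Suc 0) (Suc 0) = 0"
      using tangential[of 1 0] tangential[of 0 1] tangential[of 2 0] by auto
    then show ?thesis
      using 3 one by (auto simp: le_Suc_eq psi_monom_def Omega_def)
  qed
qed

text \<open>Serves twice: for \<open>psi\<close> composed with a rotation, and for an arbitrary
  circular integral functional.\<close>

lemma psi_unique:
  fixes \<phi> :: "'a::field_char_0 poly poly \<Rightarrow> 'a"
  assumes "Vector_Spaces.linear scale2 (*) \<phi>" and "\<phi> 1 = 1"
    and "\<And>k l. \<phi> (\<alpha>1 ^ (k + 2) * \<alpha>2 ^ l) + \<phi> (\<alpha>1 ^ k * \<alpha>2 ^ (l + 2)) = \<phi> (\<alpha>1 ^ k * \<alpha>2 ^ l)"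
    and "\<And>k l. of_nat l * \<phi> (\<alpha>1 ^ (k + 1) * \<alpha>2 ^ (l - 1))
      = of_nat k * \<phi> (\<alpha>1 ^ (k - 1) * \<alpha>2 ^ (l + 1))"
  shows "\<phi> = psi"
proof (rule linear_eqI[OF assms(1) psi_linear])
  fix k l
  show "\<phi> (\<alpha>1 ^ k * \<alpha>2 ^ l) = psi (\<alpha>1 ^ k * \<alpha>2 ^ l)"
    unfolding psi_monomial_aux
    by (rule circle_moments_unique) (use assms(2-4) in auto)
qed

section \<open>Locality\<close>

lemma psi_add: "psi (p + q) = psi p + psi q" and psi_scale2: "psi (scale2 c p) = c * psi p"
  using psi_linear linear_scale2_iff by blast+

lemma psi_radial: "psi (p * (\<alpha>1\<^sup>2 + \<alpha>2\<^sup>2)) = psi p"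
proof (induction p rule: monomial_induct)
  case (1 p q)
  then show ?case
    by (simp add: psi_add distrib_right)
next
  case (2 c k l)
  have "\<alpha>1 ^ k * \<alpha>2 ^ l * (\<alpha>1\<^sup>2 + \<alpha>2\<^sup>2)
      = \<alpha>1 ^ (k + 2) * \<alpha>2 ^ l + \<alpha>1 ^ k * (\<alpha>2 ^ (l + 2) :: 'a poly poly)"
    by (simp only: power_add distrib_left mult_ac)
  then have "psi (\<alpha>1 ^ k * \<alpha>2 ^ l * (\<alpha>1\<^sup>2 + \<alpha>2\<^sup>2)) = (psi (\<alpha>1 ^ k * \<alpha>2 ^ l) :: 'a)"
    by (simp only: psi_add psi_monomial_aux psi_monom_radial)
  then show ?case
    by (simp add: psi_scale2)
qed

section \<open>Points of the circle and division by its equation\<close>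

text \<open>The field may contain a square root of -1, so the circle is parametrised by natural
  numbers only, where the denominator is a positive integer.\<close>

lemma one_plus_square_neq_0: "1 + (of_nat n)\<^sup>2 \<noteq> (0 :: 'a::field_char_0)"
proof -
  have "1 + (of_nat n)\<^sup>2 = (of_nat (1 + n\<^sup>2) :: 'a)"
    by simp
  then show ?thesis
    by (simp only: of_nat_eq_0_iff)
qed

lemma circle_parametrisation:
  fixes t :: "'a::field"
  assumes "1 + t\<^sup>2 \<noteq> 0"
  shows "((1 - t\<^sup>2) / (1 + t\<^sup>2))\<^sup>2 + (2 * t / (1 + t\<^sup>2))\<^sup>2 = 1"
proof -
  have "((1 - t\<^sup>2) / (1 + t\<^sup>2))\<^sup>2 + (2 * t / (1 + t\<^sup>2))\<^sup>2 = ((1 - t\<^sup>2)\<^sup>2 + (2 * t)\<^sup>2) / (1 + t\<^sup>2)\<^sup>2"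
    by (simp add: power_divide add_divide_distrib)
  also have "(1 - t\<^sup>2)\<^sup>2 + (2 * t)\<^sup>2 = (1 + t\<^sup>2)\<^sup>2"
    by (simp add: power2_eq_square algebra_simps)
  finally show ?thesis
    using assms by simp
qed

lemma poly_eq_0_of_nat:
  fixes p :: "'a::field_char_0 poly"
  assumes "\<And>n. poly p (of_nat n) = 0"
  shows "p = 0"
proof (rule ccontr)
  assume "p \<noteq> 0"
  then have "finite {x. poly p x = 0}"
    by (rule poly_roots_finite)
  moreover have "range of_nat \<subseteq> {x. poly p x = 0}"
    using assms by auto
  ultimately show False
    using infinite_UNIV_char_0 finite_subset finite_imageD[of of_nat UNIV]
    by (metis infinite_UNIV_nat inj_of_nat)
qed

lemma circle_abscissae_infinite:
  "infinite {x :: 'a::field_char_0. \<exists>y. y \<noteq> 0 \<and> x\<^sup>2 + y\<^sup>2 = 1}"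
proof -
  \<comment> \<open>\<open>Suc n\<close> avoids the parameter 0, whose point has ordinate 0.\<close>
  let ?f = "\<lambda>n. (1 - (of_nat (Suc n))\<^sup>2) / (1 + (of_nat (Suc n))\<^sup>2) :: 'a"
  have f: "?f n = 2 / of_nat (1 + (Suc n)\<^sup>2) - 1" for n
    using one_plus_square_neq_0[of "Suc n", where 'a='a]
    by (simp add: divide_simps del: of_nat_Suc) (simp add: algebra_simps)
  have "inj ?f"
  proof (rule injI)
    fix m n
    assume "?f m = ?f n"
    then have "(2 :: 'a) / of_nat (1 + (Suc m)\<^sup>2) = 2 / of_nat (1 + (Suc n)\<^sup>2)"
      unfolding f by simp
    then have "(of_nat (1 + (Suc m)\<^sup>2) :: 'a) = of_nat (1 + (Suc n)\<^sup>2)"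
      by (simp only: divide_cancel_left) simp
    then have "(Suc m)\<^sup>2 = (Suc n)\<^sup>2"
      by (simp only: of_nat_eq_iff)
    then show "m = n"
      by simp
  qed
  moreover have "range ?f \<subseteq> {x. \<exists>y. y \<noteq> 0 \<and> x\<^sup>2 + y\<^sup>2 = 1}"
  proof clarify
    fix n
    have "2 * of_nat (Suc n) / (1 + (of_nat (Suc n))\<^sup>2) \<noteq> (0 :: 'a)"
      using one_plus_square_neq_0[of "Suc n", where 'a='a] by (simp del: of_nat_Suc)
    then show "\<exists>y. y \<noteq> 0 \<and> (?f n)\<^sup>2 + y\<^sup>2 = 1"
      using circle_parametrisation[OF one_plus_square_neq_0[of "Suc n", where 'a='a]] by blast
  qed
  ultimately show ?thesis
    using finite_subset range_inj_infinite by blast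
qed

lemma poly_eq_0_circle:
  fixes p :: "'a::field_char_0 poly"
  assumes "\<And>x y. x\<^sup>2 + y\<^sup>2 = 1 \<Longrightarrow> y \<noteq> 0 \<Longrightarrow> poly p x = 0"
  shows "p = 0"
proof (rule ccontr)
  assume "p \<noteq> 0"
  then have "finite {x. poly p x = 0}"
    by (rule poly_roots_finite)
  moreover have "{x. \<exists>y. y \<noteq> 0 \<and> x\<^sup>2 + y\<^sup>2 = 1} \<subseteq> {x. poly p x = 0}"
    using assms by blast
  ultimately show False
    using circle_abscissae_infinite finite_subset by blast
qed

text \<open>As a polynomial in \<open>\<alpha>2\<close> the divisor is monic of degree 2, so a
  remainder linear in \<open>\<alpha>2\<close> can be reached.\<close>

lemma circle_division:
  fixes p :: "'a::comm_ring_1 poly poly"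
  obtains q a b where "p = q * (\<alpha>1\<^sup>2 + \<alpha>2\<^sup>2 - 1) + [:a, b:]"
proof -
  have "\<exists>q a b. p = q * (\<alpha>1\<^sup>2 + \<alpha>2\<^sup>2 - 1) + [:a, b:]"
  proof (induction p)
    case 0
    have "0 = 0 * (\<alpha>1\<^sup>2 + \<alpha>2\<^sup>2 - 1) + [:0, 0 :: 'a poly:]"
      by simp
    then show ?case
      by blast
  next
    case (pCons e p)
    then obtain q a b where p: "p = q * (\<alpha>1\<^sup>2 + \<alpha>2\<^sup>2 - 1) + [:a, b:]"
      by blast
    define x where "x = [:0, 1 :: 'a:]"
    have x: "\<alpha>1 = [:x:]"
      by (simp add: x_def \<alpha>1_def)
    have e: "pCons e p = [:e:] + \<alpha>2 * p"
      by (simp add: \<alpha>2_def)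
    have ab: "[:e + b * (1 - x\<^sup>2), a:] = [:e:] + [:b:] * (1 - \<alpha>1\<^sup>2) + \<alpha>2 * [:a:]"
      "[:a, b:] = [:a:] + \<alpha>2 * [:b:]"
      by (simp_all add: x \<alpha>2_def power2_eq_square one_pCons)
    \<comment> \<open>Multiplication by \<open>y\<close> turns the remainder into
      \<open>y * a + y\<^sup>2 * b\<close>; here \<open>y\<^sup>2\<close> is replaced by the divisor
      plus \<open>1 - x\<^sup>2\<close>.\<close>
    have division_step: "e + y * (q * (x\<^sup>2 + y\<^sup>2 - 1) + (a + y * b))
        = (b + y * q) * (x\<^sup>2 + y\<^sup>2 - 1) + (e + b * (1 - x\<^sup>2) + y * a)"
      for e y q x a b :: "'a poly poly"
      by (simp add: power2_eq_square algebra_simps)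
    have "pCons e p = ([:b:] + \<alpha>2 * q) * (\<alpha>1\<^sup>2 + \<alpha>2\<^sup>2 - 1) + [:e + b * (1 - x\<^sup>2), a:]"
      unfolding e ab(1) unfolding p ab(2) by (rule division_step)
    then show ?case
      by blast
  qed
  then show ?thesis
    using that by blast
qed

lemma eval2_hom [simp]:
  "eval2 (p + q) v = eval2 p v + eval2 q v" "eval2 (p - q) v = eval2 p v - eval2 q v"
  "eval2 (p * q) v = eval2 p v * eval2 q v" "eval2 1 v = 1" "eval2 (p ^ n) v = eval2 p v ^ n"
  "eval2 \<alpha>1 v = v $ 1" "eval2 \<alpha>2 v = v $ 2"
  by (simp_all add: eval2_def \<alpha>1_def \<alpha>2_def)

lemma psi_local:
  fixes p :: "'a::field_char_0 poly poly"
  assumes p: "\<And>v. v \<in> S1 \<Longrightarrow> eval2 p v = 0"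
  shows "psi p = 0"
proof -
  obtain q a b where q: "p = q * (\<alpha>1\<^sup>2 + \<alpha>2\<^sup>2 - 1) + [:a, b:]"
    by (rule circle_division)
  have ab: "poly a x + y * poly b x = 0" if "x\<^sup>2 + y\<^sup>2 = 1" for x y
  proof -
    have "vector [x, y] \<in> (S1 :: ('a ^ 2) set)"
      using that by (simp add: S1_def)
    from p[OF this] show ?thesis
      using that by (simp add: q) (simp add: eval2_def)
  qed
  have root: "poly a x = 0" "poly b x = 0" if xy: "x\<^sup>2 + y\<^sup>2 = 1" "y \<noteq> 0" for x y
  proof -
    \<comment> \<open>The reflected point (x, -y) also lies on the circle, which separates
      \<open>a\<close> from \<open>b\<close>.\<close>
    have "poly a x + y * poly b x = 0" "poly a x - y * poly b x = 0"
      using ab[OF xy(1)] ab[of x "- y"] xy by simp_all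
    then have "2 * poly a x = 0" "2 * (y * poly b x) = 0"
      by (simp_all add: eq_neg_iff_add_eq_0)
    then show "poly a x = 0" "poly b x = 0"
      using xy by simp_all
  qed
  have "a = 0"
    by (rule poly_eq_0_circle) (rule root(1))
  moreover have "b = 0"
    by (rule poly_eq_0_circle) (rule root(2))
  ultimately have "p = q * (\<alpha>1\<^sup>2 + \<alpha>2\<^sup>2 - 1)"
    by (simp add: q)
  then have "p + q = q * (\<alpha>1\<^sup>2 + \<alpha>2\<^sup>2)"
    by (simp only: algebra_simps) simp
  then have "psi p + psi q = psi q"
    by (metis psi_add psi_radial)
  then show ?thesis
    by simp
qed

section \<open>Infinitesimal rotations\<close>

text \<open>In \<open>'a poly poly\<close>, \<^const>\<open>pderiv\<close> differentiates by \<open>\<alpha>2\<close> and \<open>map_poly pderiv\<close> by \<open>\<alpha>1\<close>.\<close>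

definition rot_deriv :: "'a::idom poly poly \<Rightarrow> 'a poly poly" where
  "rot_deriv p = \<alpha>1 * pderiv p - \<alpha>2 * map_poly pderiv p"

lemma map_poly_pderiv_add:
  "map_poly pderiv (p + q) = map_poly pderiv p + map_poly pderiv (q :: 'a::idom poly poly)"
  by (rule poly_eqI) (simp add: coeff_map_poly pderiv_add)

text \<open>Coefficientwise, this is the product rule applied to each term of the Cauchy
  product.\<close>

lemma map_poly_pderiv_mult:
  "map_poly pderiv (p * q) = p * map_poly pderiv q + q * map_poly pderiv (p :: 'a::idom poly poly)"
proof (rule poly_eqI)
  fix n
  have "coeff (map_poly pderiv (p * q)) n
      = (\<Sum>i\<le>n. coeff p i * pderiv (coeff q (n - i))) + (\<Sum>i\<le>n. pderiv (coeff p i) * coeff q (n - i))"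
    by (simp add: coeff_map_poly coeff_mult higher_pderiv_sum[of 1, simplified] pderiv_mult sum.distrib mult.commute)
  then show "coeff (map_poly pderiv (p * q)) n
      = coeff (p * map_poly pderiv q + q * map_poly pderiv p) n"
    by (simp add: coeff_map_poly coeff_mult mult.commute[of q])
qed

lemma rot_deriv_add: "rot_deriv (p + q) = rot_deriv p + rot_deriv q"
  by (simp add: rot_deriv_def pderiv_add map_poly_pderiv_add algebra_simps)

lemma rot_deriv_mult: "rot_deriv (p * q) = p * rot_deriv q + q * rot_deriv p"
  by (simp add: rot_deriv_def pderiv_mult map_poly_pderiv_mult algebra_simps)

lemma rot_deriv_scale2: "rot_deriv (scale2 c p) = scale2 c (rot_deriv p)"
proof -
  have "rot_deriv [:[:c:]:] = 0"
    by (simp add: rot_deriv_def map_poly_pCons pderiv_pCons)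
  then have "rot_deriv ([:[:c:]:] * p) = [:[:c:]:] * rot_deriv p"
    by (simp add: rot_deriv_mult del: mult_pCons_left mult_pCons_right)
  then show ?thesis
    by simp
qed

lemma rot_deriv_gens: "rot_deriv \<alpha>1 = - \<alpha>2" "rot_deriv \<alpha>2 = \<alpha>1"
  by (simp_all add: rot_deriv_def \<alpha>1_def \<alpha>2_def map_poly_pCons pderiv_pCons one_pCons)

lemma rot_deriv_power: "rot_deriv (p ^ n) = of_nat n * p ^ (n - 1) * rot_deriv p"
proof (induction n)
  case 0
  then show ?case
    by (simp add: rot_deriv_def one_pCons map_poly_pCons pderiv_pCons)
next
  case (Suc n)
  then show ?case
    by (cases n) (simp_all add: rot_deriv_mult algebra_simps)
qed

text \<open>Stated for an arbitrary pair so as to cover both the generators and their images under a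
  rotation.\<close>

lemma rot_deriv_rotating_pair:
  assumes "rot_deriv u = - v" "rot_deriv v = u"
  shows "rot_deriv (u ^ k * v ^ l)
    = of_nat l * (u ^ (k + 1) * v ^ (l - 1)) - of_nat k * (u ^ (k - 1) * v ^ (l + 1))"
  by (simp add: rot_deriv_mult rot_deriv_power assms algebra_simps)

lemma of_nat_scale2: "of_nat n * p = scale2 (of_nat n) p"
  by (simp add: of_nat_poly)

lemma linear_of_nat_diff:
  fixes \<phi> :: "'a::field poly poly \<Rightarrow> 'a"
  assumes "Vector_Spaces.linear scale2 (*) \<phi>"
  shows "\<phi> (of_nat l * p - of_nat k * q) = of_nat l * \<phi> p - of_nat k * \<phi> q"
proof -
  have "of_nat l * p - of_nat k * q = scale2 (of_nat l) p + scale2 (- of_nat k) q"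
    by (simp only: of_nat_scale2 scale2_minus_left add_uminus_conv_diff)
  then show ?thesis
    using assms by (simp add: linear_scale2_iff)
qed

lemma psi_rot_deriv: "psi (rot_deriv p) = 0"
proof (induction p rule: monomial_induct)
  case (1 p q)
  then show ?case
    by (simp add: psi_add rot_deriv_add)
next
  case (2 c k l)
  have "psi (rot_deriv (\<alpha>1 ^ k * \<alpha>2 ^ l)) = (0 :: 'a)"
    unfolding rot_deriv_rotating_pair[OF rot_deriv_gens] linear_of_nat_diff[OF psi_linear]
      psi_monomial_aux by (simp only: psi_monom_tangential) simp
  then show ?case
    by (simp add: psi_scale2 rot_deriv_scale2)
qed

section \<open>Invariance and uniqueness\<close>

lemma matrix_inv_inverse:
  fixes A :: "'a::semiring_1 ^ 'n ^ 'm"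
  assumes "invertible A"
  shows "A ** matrix_inv A = mat 1" "matrix_inv A ** A = mat 1"
  using assms someI_ex[of "\<lambda>A'. A ** A' = mat 1 \<and> A' ** A = mat 1"]
  unfolding invertible_def matrix_inv_def by blast+

text \<open>The rows are orthonormal and the determinant is 1, which determines the second row from
  the first. Conversely, uniqueness of inverses identifies \<open>matrix_inv h\<close>, which is
  defined by choice, with the transpose.\<close>

lemma SO2_iff:
  "h \<in> SO2 \<longleftrightarrow> h $ 2 $ 2 = h $ 1 $ 1 \<and> h $ 1 $ 2 = - h $ 2 $ 1 \<and> (h $ 1 $ 1)\<^sup>2 + (h $ 2 $ 1)\<^sup>2 = 1"
  for h :: "'a::field ^ 2 ^ 2"
proof
  assume "h \<in> SO2"
  then have "h ** transpose h = mat 1" and det: "det h = 1"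
    unfolding SO2_def by (auto dest: matrix_inv_inverse(1))
  then have "(h $ 1 $ 1)\<^sup>2 + (h $ 1 $ 2)\<^sup>2 = 1" "h $ 1 $ 1 * h $ 2 $ 1 + h $ 1 $ 2 * h $ 2 $ 2 = 0"
    by (simp_all add: vec_eq_iff forall_2 matrix_matrix_mult_def sum_2 transpose_def mat_def
        power2_eq_square)
  moreover have "h $ 1 $ 1 * h $ 2 $ 2 - h $ 1 $ 2 * h $ 2 $ 1 = 1"
    using det by (simp add: det_2)
  ultimately have "h $ 2 $ 2 = h $ 1 $ 1" "h $ 1 $ 2 = - h $ 2 $ 1"
    by algebra+
  then show "h $ 2 $ 2 = h $ 1 $ 1 \<and> h $ 1 $ 2 = - h $ 2 $ 1 \<and> (h $ 1 $ 1)\<^sup>2 + (h $ 2 $ 1)\<^sup>2 = 1"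
    using \<open>(h $ 1 $ 1)\<^sup>2 + (h $ 1 $ 2)\<^sup>2 = 1\<close> by simp
next
  assume h: "h $ 2 $ 2 = h $ 1 $ 1 \<and> h $ 1 $ 2 = - h $ 2 $ 1 \<and> (h $ 1 $ 1)\<^sup>2 + (h $ 2 $ 1)\<^sup>2 = 1"
  then have 1: "h ** transpose h = mat 1" "transpose h ** h = mat 1"
    by (simp_all add: vec_eq_iff forall_2 matrix_matrix_mult_def sum_2 transpose_def mat_def
        power2_eq_square algebra_simps)
  then have inv: "invertible h"
    unfolding invertible_def by blast
  have "matrix_inv h = matrix_inv h ** (h ** transpose h)"
    by (simp add: 1)
  also have "\<dots> = transpose h"
    by (simp add: matrix_mul_assoc matrix_inv_inverse(2)[OF inv])
  finally have "matrix_inv h = transpose h" .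
  then show "h \<in> SO2"
    using inv h by (simp add: SO2_def det_2 power2_eq_square)
qed

lemma psi_act:
  fixes h :: "'a::field_char_0 ^ 2 ^ 2"
  assumes "h \<in> SO2"
  shows "psi (act h p) = psi p"
proof -
  define a b where "a = h $ 1 $ 1" and "b = h $ 2 $ 1"
  \<comment> \<open>The images of \<open>\<alpha>1\<close> and \<open>\<alpha>2\<close> under
    \<open>h\<close>. They satisfy the same derivative rules as the generators and have the same sum
    of squares.\<close>
  define u v where "u = scale2 a \<alpha>1 + scale2 b \<alpha>2" and "v = scale2 (- b) \<alpha>1 + scale2 a \<alpha>2"
  have h: "h $ 2 $ 2 = a" "h $ 1 $ 2 = - b" "a\<^sup>2 + b\<^sup>2 = 1"
    using assms by (auto simp: SO2_iff a_def b_def)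
  have act: "act h p = subst2 p u v" for p
    by (simp add: act_def u_def v_def h flip: a_def b_def)
  have rot: "rot_deriv u = - v" "rot_deriv v = u"
    by (simp_all only: u_def v_def rot_deriv_add rot_deriv_scale2 rot_deriv_gens)
      (simp_all add: scale2_minus_left)
  have "u\<^sup>2 + v\<^sup>2 = [:[:a\<^sup>2 + b\<^sup>2:]:] * (\<alpha>1\<^sup>2 + \<alpha>2\<^sup>2)"
    unfolding u_def v_def \<alpha>1_def \<alpha>2_def
    by (simp add: power2_eq_square algebra_simps)
  then have norm: "u\<^sup>2 + v\<^sup>2 = \<alpha>1\<^sup>2 + \<alpha>2\<^sup>2"
    by (simp add: h flip: one_pCons)
  have mono: "act h (\<alpha>1 ^ k * \<alpha>2 ^ l) = u ^ k * v ^ l" for k l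
    by (simp add: act subst2_monomial)
  have "(\<lambda>p. psi (act h p)) = psi"
  proof (rule psi_unique)
    show "Vector_Spaces.linear scale2 (*) (\<lambda>p. psi (act h p))"
      by (simp add: linear_scale2_iff psi_add psi_scale2 act subst2_add subst2_scale2)
    show "psi (act h 1) = 1"
      using mono[of 0 0] psi_monomial_aux[of 0 0, where 'a='a] by (simp add: psi_monom_def Omega_def)
    fix k l
    have "u ^ (k + 2) * v ^ l + u ^ k * v ^ (l + 2) = u ^ k * v ^ l * (u\<^sup>2 + v\<^sup>2)"
      by (simp only: power_add distrib_left mult_ac)
    then have "psi (u ^ (k + 2) * v ^ l + u ^ k * v ^ (l + 2)) = psi (u ^ k * v ^ l)"
      by (simp only: norm psi_radial)
    then show "psi (act h (\<alpha>1 ^ (k + 2) * \<alpha>2 ^ l)) + psi (act h (\<alpha>1 ^ k * \<alpha>2 ^ (l + 2)))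
        = psi (act h (\<alpha>1 ^ k * \<alpha>2 ^ l))"
      by (simp only: mono psi_add)
    show "of_nat l * psi (act h (\<alpha>1 ^ (k + 1) * \<alpha>2 ^ (l - 1)))
        = of_nat k * psi (act h (\<alpha>1 ^ (k - 1) * \<alpha>2 ^ (l + 1)))"
      using psi_rot_deriv[of "u ^ k * v ^ l"]
      unfolding rot_deriv_rotating_pair[OF rot] linear_of_nat_diff[OF psi_linear] mono by simp
  qed
  then show ?thesis
    by metis
qed

section \<open>Relations forced on a circular integral functional\<close>

text \<open>Evaluation at a constant \<open>t\<close> is a linear combination of the coefficients of
  \<open>Q\<close>, so it commutes with \<open>\<phi>\<close>. This turns a family of values of
  \<open>\<phi>\<close> into one polynomial in \<open>t\<close>.\<close>

lemma poly_map_poly_linear: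
  fixes \<phi> :: "'a::field poly poly \<Rightarrow> 'a"
  assumes lin: "Vector_Spaces.linear scale2 (*) \<phi>"
  shows "poly (map_poly \<phi> Q) t = \<phi> (poly Q [:[:t:]:])"
proof -
  have zero: "\<phi> 0 = 0"
    using lin unfolding linear_scale2_iff by (metis add_cancel_right_right)
  show ?thesis
  proof (induction Q)
    case (pCons a Q)
    have "poly (map_poly \<phi> (pCons a Q)) t = \<phi> a + t * \<phi> (poly Q [:[:t:]:])"
      by (simp add: map_poly_pCons zero pCons)
    also have "\<dots> = \<phi> (poly (pCons a Q) [:[:t:]:])"
      using lin by (simp add: linear_scale2_iff)
    finally show ?case .
  qed (simp add: zero)
qed

text \<open>After multiplication by (1+t^2)^(k+l), invariance equates a polynomial in t with a
  constant multiple of (1+t^2)^(k+l). The latter has no linear term, while the linear term of the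
  former is \<open>\<phi>\<close> of -2 times \<open>rot_deriv\<close> of the monomial.\<close>

lemma circular_tangential:
  fixes \<phi> :: "'a::field_char_0 poly poly \<Rightarrow> 'a"
  assumes "circular_integral_functional \<phi>"
  shows "of_nat l * \<phi> (\<alpha>1 ^ (k + 1) * \<alpha>2 ^ (l - 1)) = of_nat k * \<phi> (\<alpha>1 ^ (k - 1) * \<alpha>2 ^ (l + 1))"
proof -
  have lin: "Vector_Spaces.linear scale2 (*) \<phi>"
    and inv: "\<And>p h. h \<in> SO2 \<Longrightarrow> \<phi> (act h p) = \<phi> p"
    using assms by (auto simp: circular_integral_functional_def)
  have zero: "\<phi> 0 = 0"
    using lin unfolding linear_scale2_iff by (metis add_cancel_right_right)
  \<comment> \<open>The images of \<open>\<alpha>1\<close> and \<open>\<alpha>2\<close> under the rotation with parameter \<open>t\<close>, multiplied by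
    \<open>1 + t\<^sup>2\<close>, as polynomials in \<open>t\<close>.\<close>
  define X Y :: "'a poly poly poly" where "X = [:\<alpha>1, 2 * \<alpha>2, - \<alpha>1:]" and "Y = [:\<alpha>2, - 2 * \<alpha>1, - \<alpha>2:]"
  define Q where "Q = X ^ k * Y ^ l"
  define c where "c = \<phi> (\<alpha>1 ^ k * \<alpha>2 ^ l)"
  define R where "R = map_poly \<phi> Q - smult c ([:1, 0, 1:] ^ (k + l))"
  have "poly R (of_nat n) = 0" for n
  proof -
    define t s :: 'a where "t = of_nat n" and "s = 1 + t\<^sup>2"
    have s: "s \<noteq> 0"
      unfolding s_def t_def by (rule one_plus_square_neq_0)
    \<comment> \<open>The rotation for which \<open>t\<close> is the tangent of half the
      angle.\<close>
    define h :: "'a ^ 2 ^ 2" where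
      "h = vector [vector [(1 - t\<^sup>2) / s, - (2 * t / s)], vector [2 * t / s, (1 - t\<^sup>2) / s]]"
    have h: "h $ 1 $ 1 = (1 - t\<^sup>2) / s" "h $ 1 $ 2 = - (2 * t / s)"
      "h $ 2 $ 1 = 2 * t / s" "h $ 2 $ 2 = (1 - t\<^sup>2) / s"
      by (simp_all add: h_def)
    have "h \<in> SO2"
      using circle_parametrisation[of t] s by (simp add: SO2_iff h flip: s_def)
    define u v where "u = scale2 ((1 - t\<^sup>2) / s) \<alpha>1 + scale2 (2 * t / s) \<alpha>2"
      and "v = scale2 (- (2 * t / s)) \<alpha>1 + scale2 ((1 - t\<^sup>2) / s) \<alpha>2"
    have act: "act h (\<alpha>1 ^ k * \<alpha>2 ^ l) = u ^ k * v ^ l"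
      by (simp add: act_def u_def v_def subst2_monomial h)
    have "poly X [:[:t:]:] = scale2 s u"
      using s by (simp add: X_def u_def \<alpha>1_def \<alpha>2_def numeral_poly power2_eq_square right_diff_distrib one_pCons)
    moreover have "poly Y [:[:t:]:] = scale2 s v"
      using s by (simp add: Y_def v_def \<alpha>1_def \<alpha>2_def numeral_poly power2_eq_square right_diff_distrib one_pCons)
    ultimately have "poly Q [:[:t:]:] = scale2 s u ^ k * scale2 s v ^ l"
      by (simp add: Q_def)
    also have "\<dots> = scale2 (s ^ (k + l)) (act h (\<alpha>1 ^ k * \<alpha>2 ^ l))"
      by (simp add: act smult_power power_add poly_const_pow mult.commute)
    finally have "poly (map_poly \<phi> Q) t = s ^ (k + l) * c"
      using lin by (simp add: poly_map_poly_linear linear_scale2_iff inv[OF \<open>h \<in> SO2\<close>] c_def)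
    then show ?thesis
      by (simp add: R_def s_def power2_eq_square flip: t_def)
  qed
  then have "R = 0"
    by (rule poly_eq_0_of_nat)
  \<comment> \<open>Reading the linear coefficient as a derivative at 0 makes the product and power
    rules available.\<close>
  have coeff1: "coeff P 1 = poly (pderiv P) 0" for P :: "'b::idom poly"
    by (simp add: poly_0_coeff_0 coeff_pderiv)
  have "coeff ([:1, 0, 1:] ^ (k + l) :: 'a poly) 1 = 0"
    unfolding coeff1 by (simp add: pderiv_power pderiv_pCons)
  then have "coeff (map_poly \<phi> Q) 1 = 0"
    using \<open>R = 0\<close> by (simp add: R_def)
  then have "\<phi> (coeff Q 1) = 0"
    by (simp add: coeff_map_poly zero)
  moreover have "coeff Q 1 = - 2 * (of_nat l * (\<alpha>1 ^ (k + 1) * \<alpha>2 ^ (l - 1))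
      - of_nat k * (\<alpha>1 ^ (k - 1) * \<alpha>2 ^ (l + 1)))"
  proof -
    have XY: "poly X 0 = \<alpha>1" "poly (pderiv X) 0 = 2 * \<alpha>2" "poly Y 0 = \<alpha>2" "poly (pderiv Y) 0 = - 2 * \<alpha>1"
      by (simp_all add: X_def Y_def pderiv_pCons)
    have "coeff Q 1 = \<alpha>1 ^ k * (of_nat l * (\<alpha>2 ^ (l - 1) * (- 2 * \<alpha>1)))
        + \<alpha>2 ^ l * (of_nat k * (\<alpha>1 ^ (k - 1) * (2 * \<alpha>2)))"
      unfolding coeff1 Q_def
      by (simp only: pderiv_mult pderiv_power poly_add poly_mult poly_smult poly_power XY)
    then show ?thesis
      by (simp add: algebra_simps)
  qed
  ultimately have "\<phi> (scale2 (- 2) (of_nat l * (\<alpha>1 ^ (k + 1) * \<alpha>2 ^ (l - 1))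
      - of_nat k * (\<alpha>1 ^ (k - 1) * \<alpha>2 ^ (l + 1)))) = 0"
    by (simp add: numeral_poly)
  then have "\<phi> (of_nat l * (\<alpha>1 ^ (k + 1) * \<alpha>2 ^ (l - 1))
      - of_nat k * (\<alpha>1 ^ (k - 1) * \<alpha>2 ^ (l + 1))) = 0"
    using lin by (simp add: linear_scale2_iff)
  then show ?thesis
    unfolding linear_of_nat_diff[OF lin] by simp
qed

text \<open>The two sides differ by the value of \<open>\<phi>\<close> at a multiple of the circle
  equation, which locality sends to 0.\<close>

lemma circular_radial:
  fixes \<phi> :: "'a::field_char_0 poly poly \<Rightarrow> 'a"
  assumes "circular_integral_functional \<phi>"
  shows "\<phi> (\<alpha>1 ^ (k + 2) * \<alpha>2 ^ l) + \<phi> (\<alpha>1 ^ k * \<alpha>2 ^ (l + 2)) = \<phi> (\<alpha>1 ^ k * \<alpha>2 ^ l)"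
proof -
  have add: "\<And>p q. \<phi> (p + q) = \<phi> p + \<phi> q"
    and loc: "\<And>p. (\<And>v. v \<in> S1 \<Longrightarrow> eval2 p v = 0) \<Longrightarrow> \<phi> p = 0"
    using assms by (auto simp: circular_integral_functional_def linear_scale2_iff)
  have "\<phi> (\<alpha>1 ^ k * \<alpha>2 ^ l * (\<alpha>1\<^sup>2 + \<alpha>2\<^sup>2 - 1)) = 0"
    by (rule loc) (simp add: S1_def)
  moreover have "\<alpha>1 ^ (k + 2) * \<alpha>2 ^ l + \<alpha>1 ^ k * \<alpha>2 ^ (l + 2)
      = \<alpha>1 ^ k * \<alpha>2 ^ l * (\<alpha>1\<^sup>2 + \<alpha>2\<^sup>2 - 1) + (\<alpha>1 ^ k * \<alpha>2 ^ l :: 'a poly poly)"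
    by (simp add: power_add power2_eq_square algebra_simps)
  ultimately show ?thesis
    by (metis add add_0)
qed

theorem theorem3:
  "circular_integral_functional (psi :: 'a::field_char_0 poly poly \<Rightarrow> 'a) \<and>
   (\<forall>\<phi> :: 'a poly poly \<Rightarrow> 'a. circular_integral_functional \<phi> \<longrightarrow> \<phi> = psi)"
proof (intro conjI allI impI)
  have "psi 1 = (1 :: 'a)"
    using psi_monomial_aux[of 0 0, where 'a='a] by (simp add: psi_monom_def Omega_def)
  then show "circular_integral_functional (psi :: 'a poly poly \<Rightarrow> 'a)"
    unfolding circular_integral_functional_def
    using psi_linear psi_local psi_act by blast
next
  fix \<phi> :: "'a poly poly \<Rightarrow> 'a"
  assume \<phi>: "circular_integral_functional \<phi>"
  then show "\<phi> = psi"
    by (intro psi_unique circular_radial circular_tangential)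
      (simp_all add: circular_integral_functional_def)
qed

end
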